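(* Let $f\in\mathcal{F}_1$ and let $(1,f(x))=(t_{n,k})_{n,k\ge0}$ be the corresponding Lagrange array. For all integers $n,k\ge0$, the $(n,k)$-th element $\hat{t}_{n,k}$ of the inversion $(1,f(x))^!$ is given by $$\hat{t}_{n,k}=\frac{(-1)^k}{n+1}\binom{n+1}{k}\,t_{n,k}.$$
   Context: $R$ is a field of characteristic zero (for concreteness $R=\mathbb{Q}$). $\mathcal{F}_0$ is the set of formal power series $a_0+a_1x+a_2x^2+\cdots\in R[[x]]$ with $a_0\neq 0$, and $\mathcal{F}_1$ is the set of formal power series $a_1x+a_2x^2+\cdots\in R[[x]]$ with $a_1\ne 0$. $[x^n]$ denotes extraction of the coefficient of $x^n$. A Riordan array $(g(x),f(x))$ with $g\in\mathcal{F}_0$, $f\in\mathcal{F}_1$ is the lower-triangular matrix $(t_{n,k})_{n,k\ge0}$ with $t_{n,k}=[x^n]g(x)f(x)^k$. A Lagrange (or associated) array is a Riordan array of the form $(1,f(x))$, so that $t_{n,k}=[x^n]f(x)^k$. The inversion $(g(x),f(x))^!$ of a Riordan array is the array $(\hat{t}_{n,k})_{n,k\ge0}$ defined by $\sum_{n,k\ge0}\hat{t}_{n,k}x^ny^k=\frac1x\operatorname{Rev}_x\bigl(xG(x,y)\bigr)$, where $G(x,y)=\frac{g(x)}{1-yf(x)}\in R[y][[x]]$ and $\operatorname{Rev}_x$ denotes the compositional inverse in the variable $x$ (with $y$ fixed): $U(x,y)=\operatorname{Rev}_x(xG(x,y))$ is the unique series in $R[y][[x]]$ with $U(0,y)=0$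 and $U(x,y)\,G(U(x,y),y)=x$. *)

theory Defs
  imports "HOL-Computational_Algebra.Computational_Algebra"
begin

unbundle fps_syntax

definition F0 :: "'a::zero fps set" where
  "F0 = {g. g $ 0 \<noteq> 0}"

definition F1 :: "'a::zero fps set" where
  "F1 = {f. f $ 0 = 0 \<and> f $ 1 \<noteq> 0}"

definition riordan_array :: "'a::comm_ring_1 fps \<Rightarrow> 'a fps \<Rightarrow> nat \<Rightarrow> nat \<Rightarrow> 'a" where
  "riordan_array g f n k = (g * f ^ k) $ n"

abbreviation lagrange_array :: "'a::comm_ring_1 fps \<Rightarrow> nat \<Rightarrow> nat \<Rightarrow> 'a" where
  "lagrange_array f \<equiv> riordan_array 1 f"

text \<open>
  The ring \<open>R[y][[x]]\<close> is modelled by \<open>'a poly fps\<close>: the power series variable is \<open>x\<close> and the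
  polynomial variable is \<open>y\<close>.  The next two constants are the inclusion of \<open>R[[x]]\<close> and
  the element \<open>y\<close>.
\<close>

definition const_in_y :: "'a::zero fps \<Rightarrow> 'a poly fps" where
  "const_in_y f = Abs_fps (\<lambda>n. [:f $ n:])"

definition var_y :: "'a::comm_ring_1 poly fps" where
  "var_y = fps_const [:0, 1:]"

text \<open>
  The series \<open>g(x) / (1 - y f(x))\<close>.  Since \<open>'a poly\<close> is not a field, the library's \<open>inverse\<close> is
  not available; instead we use \<open>fps_right_inverse h 1\<close>, which is the multiplicative inverse
  of \<open>h\<close> whenever \<open>h\<close> has constant coefficient \<open>1\<close>, i.e. here whenever \<open>f $ 0 = 0\<close>.
\<close>

definition riordan_gf :: "'a::comm_ring_1 fps \<Rightarrow> 'a fps \<Rightarrow> 'a poly fps" where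
  "riordan_gf g f = const_in_y g * fps_right_inverse (1 - var_y * const_in_y f) 1"

text \<open>
  Compositional inverse over a commutative ring (the library's \<open>fps_inv\<close> needs a field).
  It is only meaningful if \<open>F $ 0 = 0\<close> and \<open>F $ 1\<close> is a unit; see \<open>fps_rev_ex1\<close> below.
\<close>

definition fps_rev :: "'a::comm_ring_1 fps \<Rightarrow> 'a fps" where
  "fps_rev F = (THE U. U $ 0 = 0 \<and> F oo U = fps_X)"

text \<open>
  For a series with zero constant term, \<open>fps_shift 1\<close> is division by \<open>x\<close>.
\<close>

definition riordan_inversion :: "'a::comm_ring_1 fps \<Rightarrow> 'a fps \<Rightarrow> nat \<Rightarrow> nat \<Rightarrow> 'a" where
  "riordan_inversion g f n k =
     coeff (fps_shift 1 (fps_rev (fps_X * riordan_gf g f)) $ n) k"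

lemma riordan_gf_eq:
  assumes "f \<in> F1"
  shows "riordan_gf g f * (1 - var_y * const_in_y f) = const_in_y g"
proof -
  have "(1 - var_y * const_in_y f) $ 0 * 1 = 1"
    using assms by (simp add: F1_def var_y_def const_in_y_def)
  hence "(1 - var_y * const_in_y f) * fps_right_inverse (1 - var_y * const_in_y f) 1 = 1"
    by (rule fps_right_inverse)
  thus ?thesis
    unfolding riordan_gf_def
    by (subst mult.assoc, subst mult.commute[of "fps_right_inverse _ 1"]) (simp only: mult_1_right)
qed

fun left_compinv :: "'a::comm_ring_1 fps \<Rightarrow> 'a \<Rightarrow> nat \<Rightarrow> 'a" where
  "left_compinv F u 0 = 0"
| "left_compinv F u (Suc n) =
     (fps_X $ Suc n - (\<Sum>i = 0..n. left_compinv F u i * (F ^ i) $ Suc n)) * u ^ Suc n"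

lemma left_compinv:
  fixes F :: "'a::comm_ring_1 fps"
  assumes "F $ 0 = 0" and "F $ 1 * u = 1"
  shows "Abs_fps (left_compinv F u) oo F = fps_X"
proof (rule fps_ext)
  fix n
  show "(Abs_fps (left_compinv F u) oo F) $ n = fps_X $ n"
  proof (cases n)
    case 0
    thus ?thesis by (simp add: fps_compose_nth)
  next
    case (Suc m)
    have "(F ^ Suc m) $ Suc m * u ^ Suc m = (F $ 1 * u) ^ Suc m"
      using assms(1) by (simp only: fps_nth_power_0 startsby_zero_power_nth_same power_mult_distrib)
    hence "u ^ Suc m * (F ^ Suc m) $ Suc m = 1"
      using assms(2) by (simp only: mult.commute power_one)
    thus ?thesis
      unfolding Suc fps_compose_nth
      by (simp add: mult.assoc del: power_Suc)
  qed
qed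

lemma fps_rev_ex1:
  fixes F :: "'a::idom fps"
  assumes F_0: "F $ 0 = 0" and F_1: "F $ 1 dvd 1"
  shows "\<exists>!U. U $ 0 = 0 \<and> F oo U = fps_X"
proof -
  from F_1 obtain u where u: "F $ 1 * u = 1" by (metis dvdE)
  define L where "L = Abs_fps (left_compinv F u)"
  have L: "L oo F = fps_X" "L $ 0 = 0"
    using left_compinv[OF F_0 u] by (simp_all add: L_def)
  have "L $ 1 * F $ 1 = 1"
    using u by (simp add: L_def mult.commute)
  from left_compinv[OF L(2) this]
  obtain M where M: "M oo L = fps_X" by blast
  have "M = M oo (L oo F)" by (simp add: L)
  also have "\<dots> = (M oo L) oo F" using F_0 L(2) by (simp add: fps_compose_assoc)
  also have "\<dots> = F" using F_0 by (simp add: M)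
  finally have FL: "F oo L = fps_X" using M by simp
  show ?thesis
  proof (rule ex1I[of _ L])
    show "L $ 0 = 0 \<and> F oo L = fps_X" using FL L by simp
  next
    fix U assume U: "U $ 0 = 0 \<and> F oo U = fps_X"
    hence FU: "F oo U = fps_X" ..
    have "L = L oo (F oo U)" unfolding FU by simp
    also have "\<dots> = (L oo F) oo U" using U F_0 by (intro fps_compose_assoc) auto
    also have "\<dots> = U" using L U by (simp add: fps_X_fps_compose_startby0)
    finally show "U = L" by simp
  qed
qed

lemma fps_rev_riordan_gf:
  fixes g f :: "'a::field fps"
  assumes "g \<in> F0" and "f \<in> F1"
  defines "G \<equiv> riordan_gf g f" and "U \<equiv> fps_rev (fps_X * riordan_gf g f)"
  shows "U $ 0 = 0" and "U * (G oo U) = fps_X"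
proof -
  have "(fps_X * G) $ 1 = [:g $ 0:]"
    by (simp add: G_def riordan_gf_def const_in_y_def)
  hence "(fps_X * G) $ 1 dvd 1"
    using assms(1) by (simp add: F0_def is_unit_pCons_iff)
  hence *: "U $ 0 = 0 \<and> (fps_X * G) oo U = fps_X"
    unfolding U_def fps_rev_def G_def
    by (intro theI'[OF fps_rev_ex1]) simp_all
  show U0: "U $ 0 = 0" using * ..
  have "(fps_X * G) oo U = U * (G oo U)"
    by (subst fps_compose_mult_distrib[OF U0]) (simp only: fps_X_fps_compose_startby0[OF U0])
  thus "U * (G oo U) = fps_X" using * by simp
qed

end

theory Submission
  imports Defs
begin

text \<open>
  Lagrange inversion in the form needed for coefficients in an integral domain: with
  \<open>F = x / P\<close> and \<open>U(F(x)) = x\<close>, differentiate to \<open>U'(F) F' = 1\<close>, multiply by \<open>P\<^sup>n\<^sup>+\<^sup>1\<close> and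
  extract \<open>[x\<^sup>n]\<close>.  Since \<open>F' P\<^sup>2 = P - x P'\<close>, the series \<open>r F' P\<^sup>r\<^sup>+\<^sup>1 = r P\<^sup>r - x (P\<^sup>r)'\<close> has no
  \<open>x\<^sup>r\<close> term, so only the \<open>n\<close>-th coefficient of \<open>U'\<close> survives.  For the inversion of
  \<open>(1, f)\<close> one has \<open>P = 1 - y f(x)\<close>, and the binomial theorem gives the coefficients of
  \<open>P\<^sup>n\<^sup>+\<^sup>1\<close>.
\<close>

text \<open>Since \<open>F ^ i\<close> has no terms below degree \<open>i\<close>, every inner sum
  can be extended to the common bound \<open>n\<close>, and the two finite sums can be
  exchanged.\<close>

lemma fps_compose_mult_nth:
  fixes A F H :: "'a::idom fps"
  assumes "F $ 0 = 0"
  shows "((A oo F) * H) $ n = (\<Sum>i=0..n. A $ i * (F ^ i * H) $ n)"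
proof -
  have "((A oo F) * H) $ n = (\<Sum>j=0..n. (\<Sum>i=0..n. A $ i * (F ^ i) $ j) * H $ (n - j))"
  proof -
    have "(A oo F) $ j = (\<Sum>i=0..n. A $ i * (F ^ i) $ j)" if "j \<le> n" for j
      unfolding fps_compose_nth using assms that
      by (intro sum.mono_neutral_left) (auto simp: startsby_zero_power_prefix)
    then show ?thesis by (simp add: fps_mult_nth)
  qed
  also have "\<dots> = (\<Sum>i=0..n. A $ i * (F ^ i * H) $ n)"
    unfolding fps_mult_nth sum_distrib_left sum_distrib_right
    by (subst sum.swap) (simp add: mult.assoc)
  finally show ?thesis .
qed

text \<open>With \<open>P = x / F\<close> this is the formal residue of
  \<open>F' / F ^ (r + 1)\<close>, written without negative powers.\<close>

lemma deriv_mult_power_nth_diagonal: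
  fixes F P :: "'a::{idom,ring_char_0} fps"
  assumes FP: "F * P = fps_X" and F0: "F $ 0 = 0"
  shows "(fps_deriv F * P ^ Suc r) $ r = (if r = 0 then 1 else 0)"
proof (cases r)
  case 0
  have "(F * P) $ 1 = 1" using FP by simp
  then show ?thesis using 0 F0 by (simp add: fps_mult_nth)
next
  case (Suc s)
  have "fps_deriv (F * P) = 1" using FP by simp
  then have "P * (F * fps_deriv P + fps_deriv F * P) = P" by simp
  then have F': "fps_deriv F * P\<^sup>2 = P - fps_X * fps_deriv P"
    by (simp add: FP[symmetric] algebra_simps power2_eq_square)
  \<comment> \<open>The factor \<open>r\<close> turns \<open>P ^ (r - 1) * P'\<close> into the
    derivative of \<open>P ^ r\<close>; characteristic zero lets it be cancelled at the end.\<close>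
  have "of_nat r * (fps_deriv F * P ^ Suc r) = of_nat r * (P ^ s * (fps_deriv F * P\<^sup>2))"
    by (simp add: Suc power2_eq_square algebra_simps)
  also have "\<dots> = of_nat r * P ^ r - fps_X * fps_deriv (P ^ r)"
    unfolding F' fps_deriv_power' by (simp add: Suc algebra_simps)
  \<comment> \<open>The operator x d/dx multiplies the coefficient of \<open>x ^ r\<close> by
    \<open>r\<close>, so the two terms agree there.\<close>
  also have "\<dots> $ r = 0"
    by (simp add: Suc fps_of_nat[symmetric] del: power_Suc of_nat_Suc)
  finally have "of_nat r * (fps_deriv F * P ^ Suc r) $ r = 0"
    by (simp add: fps_of_nat[symmetric] del: power_Suc)
  then show ?thesis using Suc by (simp del: power_Suc of_nat_Suc)
qed

text \<open>The factor \<open>Suc n\<close> stays on the left because the lemma is applied over a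
  polynomial ring, where division is not at hand.\<close>

lemma lagrange_inversion:
  fixes F P U :: "'a::{idom,ring_char_0} fps"
  assumes FP: "F * P = fps_X" and F0: "F $ 0 = 0" and UF: "U oo F = fps_X"
  shows "of_nat (Suc n) * U $ Suc n = (P ^ Suc n) $ n"
proof -
  have "(fps_deriv U oo F) * fps_deriv F = fps_deriv (U oo F)"
    by (simp add: fps_compose_deriv[OF F0])
  then have "(fps_deriv U oo F) * (fps_deriv F * P ^ Suc n) = P ^ Suc n"
    by (simp add: UF mult.assoc[symmetric] del: power_Suc)
  then have "(P ^ Suc n) $ n
      = (\<Sum>i=0..n. fps_deriv U $ i * (F ^ i * (fps_deriv F * P ^ Suc n)) $ n)"
    by (metis fps_compose_mult_nth[OF F0])
  also have "\<dots> = (\<Sum>i=0..n. fps_deriv U $ i * (if i = n then 1 else 0))"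
  proof (intro sum.cong refl arg_cong2[where f = "(*)"])
    fix i assume "i \<in> {0..n}"
    then have i: "i \<le> n" by simp
    \<comment> \<open>Pairing \<open>P ^ i\<close> with \<open>F ^ i\<close> gives
      \<open>x ^ i\<close>, which lowers the index to \<open>r = n - i\<close> in the residue
      lemma.\<close>
    then have "P ^ Suc n = P ^ i * P ^ Suc (n - i)"
      by (simp add: power_add[symmetric] del: power_Suc)
    then have "F ^ i * (fps_deriv F * P ^ Suc n)
        = (F * P) ^ i * (fps_deriv F * P ^ Suc (n - i))"
      by (simp add: power_mult_distrib mult_ac del: power_Suc)
    also have "\<dots> $ n = (fps_deriv F * P ^ Suc (n - i)) $ (n - i)"
      using i by (simp add: FP fps_X_power_mult_nth del: power_Suc)
    finally show "(F ^ i * (fps_deriv F * P ^ Suc n)) $ n = (if i = n then 1 else 0)"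
      using i by (simp add: deriv_mult_power_nth_diagonal[OF FP F0] del: power_Suc)
  qed
  also have "\<dots> = fps_deriv U $ n" by (simp add: if_distrib cong: if_cong)
  finally show ?thesis by simp
qed

text \<open>The linear coefficient of \<open>U\<close> is a unit, so \<open>U\<close> has a right
  inverse \<open>V\<close> of its own, and associativity forces \<open>V = F\<close>. This supplies
  the side of the inverse that \<open>lagrange_inversion\<close> needs.\<close>

lemma fps_compose_inverse_commute:
  fixes F U :: "'a::idom fps"
  assumes F0: "F $ 0 = 0" and U0: "U $ 0 = 0" and FU: "F oo U = fps_X"
  shows "U oo F = fps_X"
proof -
  have "F $ 1 * U $ 1 = (F oo U) $ 1" by (simp add: fps_compose_nth F0)
  then have "U $ 1 dvd 1" using FU by (metis dvd_triv_right fps_X_nth)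
  then obtain V where V: "V $ 0 = 0" "U oo V = fps_X"
    using fps_rev_ex1[OF U0] by blast
  have "F = F oo (U oo V)" by (simp add: V)
  also have "\<dots> = (F oo U) oo V" by (rule fps_compose_assoc) (simp_all add: U0 V)
  also have "\<dots> = V" by (simp add: FU V)
  finally show ?thesis using V by simp
qed

lemma const_in_y_power:
  fixes f :: "'a::comm_ring_1 fps"
  shows "const_in_y (f ^ j) = const_in_y f ^ j"
proof (induction j)
  case 0
  show ?case by (simp add: const_in_y_def fps_eq_iff one_pCons)
next
  case (Suc j)
  have "const_in_y (f * h) = const_in_y f * const_in_y h" for h :: "'a fps"
    by (rule fps_ext)
      (simp add: const_in_y_def fps_mult_nth monom_0[symmetric] mult_monom monom_sum)
  then show ?case by (simp add: Suc)
qed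

lemma coeff_one_minus_y_power:
  fixes f :: "'a::comm_ring_1 fps"
  shows "coeff ((1 - var_y * const_in_y f) ^ m $ n) k
    = of_nat (m choose k) * (-1) ^ k * (f ^ k) $ n"
proof -
  \<comment> \<open>The \<open>j\<close>-th binomial term is a pure multiple of
    \<open>y ^ j\<close>, so only \<open>j = k\<close> contributes.\<close>
  have summand: "coeff ((of_nat (m choose j) * (- (var_y * const_in_y f)) ^ j) $ n) k
      = (if j = k then of_nat (m choose k) * (-1) ^ k * (f ^ k) $ n else 0)" for j
  proof -
    have y: "(var_y :: 'a poly fps) ^ j = fps_const (monom 1 j)"
      by (simp add: var_y_def monom_altdef)
    have "of_nat (m choose j) * (- (var_y * const_in_y f)) ^ j
        = fps_const (of_nat (m choose j) * (-1) ^ j * monom 1 j) * const_in_y (f ^ j)"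
      unfolding power_minus[of "var_y * const_in_y f"] power_mult_distrib y const_in_y_power
      by (simp add: fps_of_nat[symmetric] mult.assoc
          flip: fps_const_mult fps_const_power fps_const_neg)
    also have "\<dots> $ n = of_nat (m choose j) * (-1) ^ j * monom 1 j * [:(f ^ j) $ n:]"
      by (simp add: const_in_y_def)
    also have "\<dots> = monom (of_nat (m choose j) * (-1) ^ j * (f ^ j) $ n) j"
    proof -
      have "(-1 :: 'a poly) ^ j = monom ((-1) ^ j) 0"
        by (simp add: monom_0 one_pCons poly_const_pow)
      then show ?thesis
        by (simp add: of_nat_poly monom_0[symmetric] mult_monom)
    qed
    finally show ?thesis by simp
  qed
  have "(1 - var_y * const_in_y f) ^ m
      = (\<Sum>j\<le>m. of_nat (m choose j) * (- (var_y * const_in_y f)) ^ j)"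
    using binomial_ring[of "- (var_y * const_in_y f)" 1 m] by simp
  then have "coeff ((1 - var_y * const_in_y f) ^ m $ n) k
      = (\<Sum>j\<le>m. if j = k then of_nat (m choose k) * (-1) ^ k * (f ^ k) $ n else 0)"
    by (simp only: fps_sum_nth coeff_sum summand)
  \<comment> \<open>For \<open>k > m\<close> the sum is empty of matches and the binomial
    coefficient vanishes as well.\<close>
  then show ?thesis by (simp add: binomial_eq_0)
qed

theorem corollary10:
  fixes f :: "'a::field_char_0 fps" and n k :: nat
  assumes "f \<in> F1"
  shows "riordan_inversion 1 f n k =
    (-1) ^ k / of_nat (n + 1) * of_nat ((n + 1) choose k) * lagrange_array f n k"
proof -
  define G where "G = riordan_gf 1 f"
  define P where "P = 1 - var_y * const_in_y f"
  define U where "U = fps_rev (fps_X * G)"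
  have "const_in_y (1 :: 'a fps) = 1"
    by (simp add: const_in_y_def fps_eq_iff one_pCons)
  then have GP: "fps_X * G * P = fps_X"
    using riordan_gf_eq[OF assms, of 1] by (simp add: G_def P_def mult.assoc)
  have "(1 :: 'a fps) \<in> F0" by (simp add: F0_def)
  note U = fps_rev_riordan_gf[OF this assms, folded G_def, folded U_def]
  have F0: "(fps_X * G) $ 0 = 0" by simp
  have FU: "(fps_X * G) oo U = fps_X"
    by (simp only: fps_compose_mult_distrib[OF U(1)] fps_X_fps_compose_startby0[OF U(1)] U(2))
  have "of_nat (Suc n) * U $ Suc n = (P ^ Suc n) $ n"
    by (rule lagrange_inversion[OF GP F0 fps_compose_inverse_commute[OF F0 U(1) FU]])
  then have "coeff (of_nat (Suc n) * U $ Suc n) k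
      = of_nat (Suc n choose k) * (-1) ^ k * (f ^ k) $ n"
    by (simp only: P_def coeff_one_minus_y_power)
  \<comment> \<open>The integer factor is constant in \<open>y\<close>, so it passes through
    \<open>coeff\<close>; dividing \<open>U\<close> by \<open>x\<close> accounts for the index
    \<open>Suc n\<close>.\<close>
  then have "of_nat (Suc n) * riordan_inversion 1 f n k
      = of_nat (Suc n choose k) * (-1) ^ k * (f ^ k) $ n"
    by (simp add: riordan_inversion_def U_def G_def of_nat_poly del: of_nat_Suc)
  then show ?thesis
    by (simp add: riordan_array_def field_simps del: of_nat_Suc)
qed

end
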